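(* For every integer $n\ge 1$, the $\mathrm{BZ}'$-rank of $MT(K_{2n+1})$ is at least $\left\lceil \sqrt{2n}-\frac32\right\rceil$.
   Context: **Notation.** Let $d\ge 1$, $[d]=\{1,\dots,d\}$, $\mathcal F=\{0,1\}^d$, and let $\mathcal A=2^{\mathcal F}$ be the power set of $\mathcal F$. For $P\subseteq[0,1]^d$ let $P_I=\mathrm{conv}(P\cap\{0,1\}^d)$ and $K(P)=\{(\lambda,\lambda x)\in\mathbb R^{d+1}:\lambda\ge 0,\ x\in P\}$. For $S\subseteq[d]$, $t\in\{0,1\}$, let $S|_t=\{x\in\mathcal F: x_i=t\ \forall i\in S\}$ (so $\emptyset|_t=\mathcal F$) and $i|_t=\{i\}|_t$. For $U\subseteq[d]$ and an integer $r\ge0$ let $U|_{<r}=\{x\in\mathcal F:\sum_{i\in U}x_i\le r-1\}$. Matrices have rows and columns indexed by subfamilies of $\mathcal A$; $Ye_\alpha$ is the column of $Y$ indexed by $\alpha$. For a vector $y$ indexed by a family containing $\mathcal F$ and all $i|_1$, $\hat x(y)=(y_{\mathcal F},y_{1|_1},\dots,y_{d|_1})^\top$; for $x\in\mathbb R^d$, $\hat x=(1,x)\in\mathbb R^{d+1}$. **The operator $\mathrm{BZ}'^k$ ($k\ge1$).** The input is $P=\{x\in[0,1]^d:Ax\le b\}$ with $A\in\mathbb R^{m\times d}$ nonnegative and $b\in\mathbb R^m$ positive; the operator depends on the system $Ax\le b$. Let $A^i$ be the $i$-th row of $A$. A set $O\subseteq[d]$ is a $k$-small obstruction if for some $i\in[m]$: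 $O\subseteq\mathrm{supp}(A^i)$, $\sum_{j\in O}A^i_j>b_i$, and ($|O|\le k+1$ or $|O|\ge|\mathrm{supp}(A^i)|-(k+1)$). Let $\mathcal O_k$ be the collection of all $k$-small obstructions and $\mathcal O_k(P)=\{x\in P:\sum_{i\in O}x_i\le|O|-1\ \forall O\in\mathcal O_k\}$. Walls: $\mathcal W_k=\{\bigcup_{i,j\in[\ell],i\ne j}(O_i\cap O_j):O_1,\dots,O_\ell\in\mathcal O_k,\ 2\le\ell\le k+1\}\cup\{\{1\},\dots,\{d\}\}$. Tiers: $\mathcal T_k=\{S\subseteq[d]:\exists W_1,\dots,W_k\in\mathcal W_k,\ S\subseteq\bigcup_{j=1}^kW_j\}$. Let $\mathcal A'$ consist of, for each tier $S\in\mathcal T_k$: (a) $(S\setminus T)|_1\cap T|_0$ for all $T\subseteq S$ with $|T|\le k$; (b) $(S\setminus(T\cup U))|_1\cap T|_0\cap U|_{<|U|-(k-|T|)}$ for all $T,U\subseteq S$ with $U\cap T=\emptyset$, $|T|<k$, $|U|+|T|>k$. Let $\tilde{\mathrm{BZ}}'^k(P)$ be the set of symmetric real matrices $Y$ indexed by $\mathcal A'\times\mathcal A'$ such that: (BZ'1) $Y[\mathcal F,\mathcal F]=1$. (BZ'2) Every column $y$ of $Y$ satisfies: (i) $0\le y_\alpha\le y_{\mathcal F}$ for all $\alpha\in\mathcal A'$; (ii) $\hat x(y)\in K(\mathcal O_k(P))$; (iii) $y_{i|_1}+y_{i|_0}=y_{\mathcal F}$ for all $i\in[d]$; (iv) for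 each $\alpha\in\mathcal A'$ of the form $S|_1\cap T|_0$: $y_{i|_1}\ge y_\alpha$ for $i\in S$; $y_{i|_0}\ge y_\alpha$ for $i\in T$; $y_\alpha+y_{(S\cup\{i\})|_1\cap(T\setminus\{i\})|_0}=y_{S|_1\cap(T\setminus\{i\})|_0}$ for $i\in T$; $\sum_{i\in S}y_{i|_1}+\sum_{i\in T}y_{i|_0}-y_\alpha\le(|S|+|T|-1)y_{\mathcal F}$; (v) for each $\alpha\in\mathcal A'$ of the form $S|_1\cap T|_0\cap U|_{<r}$: $y_{i|_1}\ge y_\alpha$ for $i\in S$; $y_{i|_0}\ge y_\alpha$ for $i\in T$; $\sum_{i\in U}y_{i|_0}\ge(|U|-(r-1))y_\alpha$; $y_\alpha=y_{S|_1\cap T|_0}-\sum_{U'\subseteq U,|U'|\ge r}y_{(S\cup U')|_1\cap(T\cup(U\setminus U'))|_0}$. (BZ'3) $Y[\alpha,\beta]=0$ for all $\alpha,\beta\in\mathcal A'$ with $\mathrm{conv}(\alpha)\cap\mathrm{conv}(\beta)\cap P=\emptyset$. (BZ'4) $Y[\alpha_1,\beta_1]=Y[\alpha_2,\beta_2]$ whenever $\alpha_1,\beta_1,\alpha_2,\beta_2\in\mathcal A'$ and $\alpha_1\cap\beta_1=\alpha_2\cap\beta_2$. Then $\mathrm{BZ}'^k(P)=\{x\in\mathbb R^d:\exists Y\in\tilde{\mathrm{BZ}}'^k(P),\ \hat x(Ye_{\mathcal F})=\hat x\}$. **Rank.** For an operator $\Gamma$, the $\Gamma$-rank of $P$ is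 the smallest integer $k\ge 0$ with $\Gamma^k(P)=P_I$, where $\Gamma^0(P)=P$. **Matching relaxation.** For a simple undirected graph $G=(V,E)$, $MT(G)=\{x\in[0,1]^E:\sum_{j:\{i,j\}\in E}x_{ij}\le1\ \forall i\in V\}$, given by this system of inequalities (one row for each vertex); coordinates are indexed by $E$ (so $[d]$ is identified with $E$). $K_m$ is the complete graph on $m$ vertices. *)

theory Defs
  imports "HOL-Analysis.Analysis" "HOL-Library.Extended_Nat"
begin

text \<open>
  The coordinate set \<open>[d]\<close> is the finite type \<open>'e\<close> and the row set \<open>[m]\<close> is the finite type \<open>'m\<close>,
  so a system \<open>A x \<le> b\<close> is given by \<open>A :: real ^ 'e ^ 'm\<close> and \<open>b :: real ^ 'm\<close>.
\<close>

section \<open>Polytopes in the unit cube\<close>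

definition unit_cube :: "(real ^ 'e) set" where
  "unit_cube = {x. \<forall>i. 0 \<le> x $ i \<and> x $ i \<le> 1}"

definition vertices01 :: "(real ^ 'e) set" where
  "vertices01 = {x. \<forall>i. x $ i = 0 \<or> x $ i = 1}"

definition polytope_of :: "real ^ 'e ^ 'm \<Rightarrow> real ^ 'm \<Rightarrow> (real ^ 'e) set" where
  "polytope_of A b = {x \<in> unit_cube. \<forall>i. (A *v x) $ i \<le> b $ i}"

definition integer_hull :: "(real ^ 'e) set \<Rightarrow> (real ^ 'e) set" where
  "integer_hull P = convex hull (P \<inter> vertices01)"

text \<open>The space $\mathbb{R}^{d+1}$ is represented as the product $\mathbb{R} \times \mathbb{R}^d$.\<close>

definition homog_cone :: "(real ^ 'e) set \<Rightarrow> (real \<times> (real ^ 'e)) set" where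
  "homog_cone P = {(l, l *\<^sub>R x) | l x. 0 \<le> l \<and> x \<in> P}"

section \<open>Sets of 0/1 vectors\<close>

definition fix_coords :: "'e set \<Rightarrow> real \<Rightarrow> (real ^ 'e) set" where
  "fix_coords S t = {x \<in> vertices01. \<forall>i\<in>S. x $ i = t}"

definition sum_less :: "'e::finite set \<Rightarrow> nat \<Rightarrow> (real ^ 'e) set" where
  "sum_less U r = {x \<in> vertices01. (\<Sum>i\<in>U. x $ i) \<le> real r - 1}"

text \<open>\<open>one_zero S T\<close> is $S|_1 \cap T|_0$.\<close>

definition one_zero :: "'e set \<Rightarrow> 'e set \<Rightarrow> (real ^ 'e) set" where
  "one_zero S T = fix_coords S 1 \<inter> fix_coords T 0"

text \<open>The vector $\hat x(y)$.\<close>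

definition xhat :: "((real ^ 'e) set \<Rightarrow> real) \<Rightarrow> real \<times> (real ^ 'e)" where
  "xhat y = (y vertices01, \<chi> i. y (fix_coords {i} 1))"

section \<open>Obstructions, walls and tiers\<close>

definition row_support :: "real ^ 'e ^ 'm \<Rightarrow> 'm \<Rightarrow> 'e set" where
  "row_support A i = {j. A $ i $ j \<noteq> 0}"

definition small_obstructions :: "nat \<Rightarrow> real ^ 'e::finite ^ 'm \<Rightarrow> real ^ 'm \<Rightarrow> 'e set set" where
  "small_obstructions k A b =
     {Ob. \<exists>i. Ob \<subseteq> row_support A i \<and> (\<Sum>j\<in>Ob. A $ i $ j) > b $ i \<and>
        (card Ob \<le> k + 1 \<or> int (card Ob) \<ge> int (card (row_support A i)) - int (k + 1))}"

definition obstruction_relax :: "nat \<Rightarrow> real ^ 'e::finite ^ 'm \<Rightarrow> real ^ 'm \<Rightarrow> (real ^ 'e) set" where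
  "obstruction_relax k A b =
     {x \<in> polytope_of A b. \<forall>Ob \<in> small_obstructions k A b. (\<Sum>i\<in>Ob. x $ i) \<le> real (card Ob) - 1}"

definition walls :: "nat \<Rightarrow> real ^ 'e::finite ^ 'm \<Rightarrow> real ^ 'm \<Rightarrow> 'e set set" where
  "walls k A b =
     {(\<Union>i\<in>{1..l}. \<Union>j\<in>{1..l} - {i}. Ob i \<inter> Ob j) | l (Ob :: nat \<Rightarrow> 'e set).
        2 \<le> l \<and> l \<le> k + 1 \<and> (\<forall>i\<in>{1..l}. Ob i \<in> small_obstructions k A b)}
     \<union> {{i} | i. True}"

definition tiers :: "nat \<Rightarrow> real ^ 'e::finite ^ 'm \<Rightarrow> real ^ 'm \<Rightarrow> 'e set set" where
  "tiers k A b =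
     {S. \<exists>W :: nat \<Rightarrow> 'e set. (\<forall>j\<in>{1..k}. W j \<in> walls k A b) \<and> S \<subseteq> (\<Union>j\<in>{1..k}. W j)}"

text \<open>The index family $\mathcal{A}'$. The side conditions in the second part make both natural
  number subtractions exact.\<close>

definition index_family :: "nat \<Rightarrow> real ^ 'e::finite ^ 'm \<Rightarrow> real ^ 'm \<Rightarrow> (real ^ 'e) set set" where
  "index_family k A b =
     {one_zero (S - T) T | S T. S \<in> tiers k A b \<and> T \<subseteq> S \<and> card T \<le> k}
     \<union> {one_zero (S - (T \<union> U)) T \<inter> sum_less U (card U - (k - card T)) | S T U.
          S \<in> tiers k A b \<and> T \<subseteq> S \<and> U \<subseteq> S \<and> U \<inter> T = {} \<and> card T < k \<and> card U + card T > k}"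

section \<open>The lift-and-project operator\<close>

text \<open>The conditions on each column. In the last two conjuncts all representations of an
  index \<open>\<alpha>\<close> are considered. A representation \<open>one_zero S T\<close> of an index automatically has \<open>S\<close> and
  \<open>T\<close> disjoint, since no index is empty; in the last conjunct \<open>S\<close>, \<open>T\<close>, \<open>U\<close> are required to be
  pairwise disjoint, as they are in the construction of the index family. This ensures that only
  entries of \<open>y\<close> at members of the index family occur.\<close>

definition column_ok ::
  "nat \<Rightarrow> real ^ 'e::finite ^ 'm \<Rightarrow> real ^ 'm \<Rightarrow> ((real ^ 'e) set \<Rightarrow> real) \<Rightarrow> bool" where
  "column_ok k A b y \<longleftrightarrow>
     (\<forall>\<alpha>\<in>index_family k A b. 0 \<le> y \<alpha> \<and> y \<alpha> \<le> y vertices01) \<and>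
     xhat y \<in> homog_cone (obstruction_relax k A b) \<and>
     (\<forall>i. y (fix_coords {i} 1) + y (fix_coords {i} 0) = y vertices01) \<and>
     (\<forall>S T. one_zero S T \<in> index_family k A b \<longrightarrow>
        (\<forall>i\<in>S. y (fix_coords {i} 1) \<ge> y (one_zero S T)) \<and>
        (\<forall>i\<in>T. y (fix_coords {i} 0) \<ge> y (one_zero S T)) \<and>
        (\<forall>i\<in>T. y (one_zero S T) + y (one_zero (S \<union> {i}) (T - {i})) = y (one_zero S (T - {i}))) \<and>
        (\<Sum>i\<in>S. y (fix_coords {i} 1)) + (\<Sum>i\<in>T. y (fix_coords {i} 0)) - y (one_zero S T)
          \<le> (real (card S) + real (card T) - 1) * y vertices01) \<and>
     (\<forall>S T U r. S \<inter> T = {} \<and> S \<inter> U = {} \<and> T \<inter> U = {} \<and>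
        one_zero S T \<inter> sum_less U r \<in> index_family k A b \<longrightarrow>
        (\<forall>i\<in>S. y (fix_coords {i} 1) \<ge> y (one_zero S T \<inter> sum_less U r)) \<and>
        (\<forall>i\<in>T. y (fix_coords {i} 0) \<ge> y (one_zero S T \<inter> sum_less U r)) \<and>
        (\<Sum>i\<in>U. y (fix_coords {i} 0))
          \<ge> (real (card U) - (real r - 1)) * y (one_zero S T \<inter> sum_less U r) \<and>
        y (one_zero S T \<inter> sum_less U r) =
          y (one_zero S T)
          - (\<Sum>U' \<in> {U'. U' \<subseteq> U \<and> r \<le> card U'}. y (one_zero (S \<union> U') (T \<union> (U - U')))))"

text \<open>Matrices indexed by the index family are functions of two arguments; only their values on
  the index family matter. The column of \<open>Y\<close> indexed by \<open>\<beta>\<close> is \<open>\<lambda>\<alpha>. Y \<alpha> \<beta>\<close>.\<close>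

definition BZ'_lift ::
  "nat \<Rightarrow> real ^ 'e::finite ^ 'm \<Rightarrow> real ^ 'm \<Rightarrow> ((real ^ 'e) set \<Rightarrow> (real ^ 'e) set \<Rightarrow> real) set" where
  "BZ'_lift k A b =
     {Y. (\<forall>\<alpha>\<in>index_family k A b. \<forall>\<beta>\<in>index_family k A b. Y \<alpha> \<beta> = Y \<beta> \<alpha>) \<and>
         Y vertices01 vertices01 = 1 \<and>
         (\<forall>\<beta>\<in>index_family k A b. column_ok k A b (\<lambda>\<alpha>. Y \<alpha> \<beta>)) \<and>
         (\<forall>\<alpha>\<in>index_family k A b. \<forall>\<beta>\<in>index_family k A b.
            convex hull \<alpha> \<inter> convex hull \<beta> \<inter> polytope_of A b = {} \<longrightarrow> Y \<alpha> \<beta> = 0) \<and>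
         (\<forall>\<alpha>1\<in>index_family k A b. \<forall>\<beta>1\<in>index_family k A b.
          \<forall>\<alpha>2\<in>index_family k A b. \<forall>\<beta>2\<in>index_family k A b.
            \<alpha>1 \<inter> \<beta>1 = \<alpha>2 \<inter> \<beta>2 \<longrightarrow> Y \<alpha>1 \<beta>1 = Y \<alpha>2 \<beta>2)}"

text \<open>The case \<open>k = 0\<close> is the convention $\Gamma^0(P) = P$ in the definition of the rank.\<close>

definition BZ' :: "nat \<Rightarrow> real ^ 'e::finite ^ 'm \<Rightarrow> real ^ 'm \<Rightarrow> (real ^ 'e) set" where
  "BZ' k A b =
     (if k = 0 then polytope_of A b
      else {x. \<exists>Y \<in> BZ'_lift k A b. xhat (\<lambda>\<alpha>. Y \<alpha> vertices01) = (1, x)})"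

text \<open>The rank is \<open>\<infinity>\<close> if no power of the operator reaches the integer hull.\<close>

definition BZ'_rank :: "real ^ 'e::finite ^ 'm \<Rightarrow> real ^ 'm \<Rightarrow> enat" where
  "BZ'_rank A b = (INF k \<in> {k. BZ' k A b = integer_hull (polytope_of A b)}. enat k)"

section \<open>The matching relaxation\<close>

text \<open>A simple graph on the vertex type \<open>'v\<close> has an edge set of two-element subsets of \<open>'v\<close>. The
  coordinates are identified with the edges by a bijection \<open>ends\<close> from \<open>'e\<close> to the edge set.\<close>

definition complete_graph_edges :: "'v set set" where
  "complete_graph_edges = {{u, v} | u v. u \<noteq> v}"

definition MT_matrix :: "('e \<Rightarrow> 'v set) \<Rightarrow> real ^ 'e ^ 'v" where
  "MT_matrix ends = (\<chi> v e. if v \<in> ends e then 1 else 0)"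

definition MT_rhs :: "real ^ 'v" where
  "MT_rhs = (\<chi> v. 1)"

lemma polytope_of_MT:
  fixes ends :: "'e::finite \<Rightarrow> 'v::finite set"
  shows "polytope_of (MT_matrix ends) MT_rhs =
    {x \<in> unit_cube. \<forall>v. (\<Sum>e | v \<in> ends e. x $ e) \<le> 1}"
proof -
  have "(MT_matrix ends *v x) $ v = (\<Sum>e | v \<in> ends e. x $ e)" for x :: "real ^ 'e" and v
    by (simp add: MT_matrix_def matrix_vector_mult_def sum.If_cases if_distrib[of "\<lambda>c. c * _"]
        cong: if_cong)
  then show ?thesis
    by (simp add: polytope_of_def MT_rhs_def)
qed

end

theory Submission
  imports Defs "HOL-Number_Theory.Cong"
begin

text \<open>
  A signed measure \<open>\<mu>\<close> on the matchings of \<open>K\<^bsub>2n+1\<^esub>\<close> yields the matrix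
  \<open>Y \<alpha> \<beta> = \<mu> (\<alpha> \<inter> \<beta>)\<close>, for which all equations in the definition of the lift hold
  automatically. Let \<open>\<mu>\<close> be \<open>1 + \<epsilon>\<close> times the uniform distribution on the matchings of size \<open>n\<close>
  minus \<open>\<epsilon>\<close> times the point mass at the empty matching. The expected size of a matching is then
  \<open>(1 + \<epsilon>) n > n\<close>, so the projection of \<open>Y\<close> lies outside the integer hull. For small \<open>\<epsilon>\<close>, an
  integral that has to be nonnegative can only fail to be so if its integrand is positive at the
  empty matching and vanishes at all matchings of size \<open>n\<close>. This does not happen: the integrands
  that occur are positive at each matching of size \<open>n\<close> that avoids at most \<open>2k + 3\<close> given edges and
  possibly a given vertex, and such a matching exists because the edges of \<open>K\<^bsub>2n\<^esub>\<close> decompose into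
  \<open>2n - 1\<close> perfect matchings.
\<close>

section \<open>Perfect matchings avoiding few edges\<close>

text \<open>The round-robin colouring of the edges of the complete graph on \<open>{..p}\<close>, \<open>p\<close> odd,
  where \<open>p\<close> plays the role of the point at infinity.\<close>

definition round_robin :: "nat \<Rightarrow> nat \<Rightarrow> nat \<Rightarrow> nat" where
  "round_robin p i j =
     (if i = p then 2 * j else if j = p then 2 * i else i + j) mod p"

lemma round_robin_sym: "round_robin p i j = round_robin p j i"
  by (auto simp: round_robin_def add.commute)

text \<open>Injectivity suffices, since both sides have p elements. At the point p it holds because
  2 is invertible modulo the odd number p; at any other point a residue can be cancelled.\<close>

lemma round_robin_surj:
  assumes "odd p" "i \<le> p"
  shows "bij_betw (round_robin p i) ({..p} - {i}) {..<p}"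
proof -
  have p: "p > 0" using assms(1) by (rule odd_pos)
  have inj: "inj_on (round_robin p i) ({..p} - {i})"
  proof (cases "i = p")
    case True
    have "a = b" if "a \<in> {..p} - {i}" "b \<in> {..p} - {i}"
      "round_robin p i a = round_robin p i b" for a b
    proof -
      have "[2 * a = 2 * b] (mod p)" using that(3) True by (simp add: cong_def round_robin_def)
      then have "[a = b] (mod p)"
        using assms(1) by (subst (asm) cong_mult_lcancel_nat) auto
      moreover have "a < p" "b < p" using that(1,2) True by auto
      ultimately show ?thesis by (simp add: cong_def)
    qed
    then show ?thesis by (auto intro: inj_onI)
  next
    case False
    \<comment> \<open>The colour 2i of the edge from i to p equals i + i, so p takes over the
      residue i, which no neighbour of i uses.\<close>
    define s where "s j = (if j = p then i else j)" for j
    have s: "round_robin p i j = (i + s j) mod p" for j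
      using False by (simp add: round_robin_def s_def mult_2)
    have "a = b" if "a \<in> {..p} - {i}" "b \<in> {..p} - {i}"
      "round_robin p i a = round_robin p i b" for a b
    proof -
      have "[i + s a = i + s b] (mod p)" using that(3) by (simp add: s cong_def)
      then have "[s a = s b] (mod p)" by (simp add: cong_add_lcancel_nat)
      moreover have "s a < p" "s b < p" using that False assms(2) by (auto simp: s_def)
      ultimately have "s a = s b" by (simp add: cong_def)
      then show ?thesis using that(1,2) by (auto simp: s_def split: if_splits)
    qed
    then show ?thesis by (auto intro: inj_onI)
  qed
  have "round_robin p i ` ({..p} - {i}) = {..<p}"
  proof (rule card_subset_eq)
    show "round_robin p i ` ({..p} - {i}) \<subseteq> {..<p}"
      using p by (auto simp: round_robin_def)
    show "card (round_robin p i ` ({..p} - {i})) = card {..<p}"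
      using inj assms(2) by (simp add: card_image)
  qed simp
  with inj show ?thesis by (simp add: bij_betw_def)
qed

text \<open>The 2m - 1 colour classes are pairwise disjoint, so fewer than 2m - 1 edges cannot meet
  them all. A class is a perfect matching because the colours at each vertex form a
  bijection.\<close>

lemma perfect_matching_avoiding:
  fixes X :: "'a set" and Z :: "'a set set"
  assumes "finite X" "card X = 2 * m" "m \<ge> 1" "finite Z" "card Z \<le> 2 * m - 2"
  obtains F where "F \<subseteq> {{u, w} | u w. u \<in> X \<and> w \<in> X \<and> u \<noteq> w}" "F \<inter> Z = {}"
    "\<And>u. u \<in> X \<Longrightarrow> \<exists>!e. e \<in> F \<and> u \<in> e"
proof -
  define p where "p = 2 * m - 1"
  have p: "odd p" "Suc p = 2 * m" using assms(3) by (auto simp: p_def)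
  obtain h where h: "bij_betw h X {..p}"
    using assms(1,2) p(2) by (metis bij_betw_iff_card card_atMost finite_atMost)
  define F where "F c = {{u, w} | u w. u \<in> X \<and> w \<in> X \<and> u \<noteq> w \<and>
    round_robin p (h u) (h w) = c}" for c
  have colour: "round_robin p (h u) (h w) = c" if "{u, w} \<in> F c" for u w c
    using that by (auto simp: F_def doubleton_eq_iff round_robin_sym)
  have "\<exists>c<p. F c \<inter> Z = {}"
  proof (rule ccontr)
    assume "\<not> ?thesis"
    then have "\<forall>c. \<exists>e. c < p \<longrightarrow> e \<in> F c \<inter> Z" by blast
    \<comment> \<open>If every class met \<open>Z\<close>, choosing one common edge per class would
      inject the p colours into \<open>Z\<close>.\<close>
    then obtain f where f: "\<And>c. c < p \<Longrightarrow> f c \<in> F c \<inter> Z" by metis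
    have "inj_on f {..<p}"
    proof (rule inj_onI)
      fix c d assume cd: "c \<in> {..<p}" "d \<in> {..<p}" "f c = f d"
      have "f c \<in> F c" using f[of c] cd(1) by auto
      then obtain u w where uw: "f c = {u, w}" by (auto simp: F_def)
      with f[of c] f[of d] cd show "c = d" by (metis IntE colour lessThan_iff)
    qed
    then have "card {..<p} \<le> card Z"
      using f assms(4) by (intro card_inj_on_le) auto
    then show False using assms(3,5) by (simp add: p_def)
  qed
  then obtain c where c: "c < p" "F c \<inter> Z = {}" by blast
  show ?thesis
  proof
    show "F c \<subseteq> {{u, w} | u w. u \<in> X \<and> w \<in> X \<and> u \<noteq> w}" by (auto simp: F_def)
    show "F c \<inter> Z = {}" by (rule c(2))
    fix u assume u: "u \<in> X"
    then have hu: "h u \<le> p" using h by (auto simp: bij_betw_def)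
    have rr: "bij_betw (round_robin p (h u)) ({..p} - {h u}) {..<p}"
      using p(1) hu by (rule round_robin_surj)
    obtain j where j: "j \<in> {..p} - {h u}" "round_robin p (h u) j = c"
      using rr c(1) by (metis bij_betw_imp_surj_on imageE lessThan_iff)
    obtain w where w: "w \<in> X" "h w = j" using h j(1) by (metis DiffE bij_betw_imp_surj_on imageE)
    show "\<exists>!e. e \<in> F c \<and> u \<in> e"
    proof
      show "{u, w} \<in> F c \<and> u \<in> {u, w}" using u w j by (auto simp: F_def)
      fix e assume e: "e \<in> F c \<and> u \<in> e"
      then obtain w' where w': "e = {u, w'}" "w' \<in> X" "u \<noteq> w'"
        by (auto simp: F_def)
      have "round_robin p (h u) (h w') = c" using e w'(1) by (metis colour)
      moreover have "h w' \<in> {..p} - {h u}"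
        using h w' u by (auto simp: bij_betw_def inj_on_def)
      ultimately have "h w' = j" using rr j by (metis bij_betw_imp_inj_on inj_onD)
      then show "e = {u, w}" using h w w' by (metis bij_betw_imp_inj_on inj_onD)
    qed
  qed
qed

section \<open>Members of the index family\<close>

definition ivec :: "'e::finite set \<Rightarrow> real ^ 'e" where
  "ivec M = (\<chi> e. if e \<in> M then 1 else 0)"

lemma ivec_nth [simp]: "ivec M $ e = (if e \<in> M then 1 else 0)"
  by (simp add: ivec_def)

lemma ivec_in_vertices01 [simp]: "ivec M \<in> vertices01"
  by (simp add: vertices01_def)

lemma ivec_in_fix_coords_1 [simp]: "ivec M \<in> fix_coords S 1 \<longleftrightarrow> S \<subseteq> M"
  by (auto simp: fix_coords_def)

lemma ivec_in_fix_coords_0 [simp]: "ivec M \<in> fix_coords T 0 \<longleftrightarrow> T \<inter> M = {}"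
  by (auto simp: fix_coords_def)

lemma ivec_in_one_zero [simp]: "ivec M \<in> one_zero S T \<longleftrightarrow> S \<subseteq> M \<and> T \<inter> M = {}"
  by (simp add: one_zero_def)

lemma sum_ivec: "(\<Sum>i\<in>U. ivec M $ i) = real (card (U \<inter> M))"
  by (simp add: sum.If_cases)

lemma ivec_in_sum_less [simp]: "ivec M \<in> sum_less U r \<longleftrightarrow> card (U \<inter> M) < r"
  unfolding sum_less_def mem_Collect_eq sum_ivec by auto

lemma index_family_cases:
  assumes "\<alpha> \<in> index_family k A b"
  obtains S T where "\<alpha> = one_zero S T" "S \<inter> T = {}" "card T \<le> k"
  | S T U where "\<alpha> = one_zero S T \<inter> sum_less U (card U - (k - card T))"
      "S \<inter> T = {}" "S \<inter> U = {}" "U \<inter> T = {}" "card T < k" "card U + card T > k"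
  using assms unfolding index_family_def by blast

text \<open>Containing the zero vector forces S to be empty. Zeros on T and on k - |T| + 1 elements
  of U then guarantee membership, which makes k + 1 prescribed zeros in all.\<close>

lemma index_family_zero:
  assumes "\<alpha> \<in> index_family k A b" "ivec {} \<in> \<alpha>"
  obtains Z where "card Z \<le> k + 1" "\<And>M. M \<inter> Z = {} \<Longrightarrow> ivec M \<in> \<alpha>"
  using assms(1)
proof (cases rule: index_family_cases)
  case (1 S T)
  with assms(2) that[of T] show ?thesis by auto
next
  case (2 S T U)
  have S: "S = {}" using assms(2) 2 by auto
  obtain Q where Q: "Q \<subseteq> U" "card Q = k - card T + 1"
  proof (rule obtain_subset_with_card_n)
    show "k - card T + 1 \<le> card U" using 2 by simp
  qed
  show ?thesis
  proof (rule that[of "T \<union> Q"])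
    show "card (T \<union> Q) \<le> k + 1" using card_Un_le[of T Q] Q 2(5) by simp
    fix M assume M: "M \<inter> (T \<union> Q) = {}"
    have "card (U \<inter> M) \<le> card (U - Q)" using M by (intro card_mono) auto
    also have "\<dots> = card U - card Q" using Q by (simp add: card_Diff_subset)
    also have "\<dots> < card U - (k - card T)" using Q 2 by simp
    finally show "ivec M \<in> \<alpha>" using M S 2(1) by auto
  qed
qed

text \<open>The bound on U is positive because |U| + |T| > k, so only a coordinate fixed to 1 can
  exclude the zero vector.\<close>

lemma index_family_nonzero:
  assumes "\<alpha> \<in> index_family k A b" "ivec {} \<notin> \<alpha>"
  obtains s where "\<And>M. ivec M \<in> \<alpha> \<Longrightarrow> s \<in> M"
  using assms(1)
proof (cases rule: index_family_cases)
  case (1 S T)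
  then obtain s where "s \<in> S" using assms(2) by auto
  with 1 that[of s] show ?thesis by auto
next
  case (2 S T U)
  then obtain s where "s \<in> S" using assms(2) by auto
  with 2 that[of s] show ?thesis by auto
qed

text \<open>This property does not refer to a representation of the index. It later bounds |U| - r
  for every way of writing the index.\<close>

lemma index_family_few_zeros:
  assumes "\<alpha> \<in> index_family k A b"
  obtains M where "ivec M \<in> \<alpha>" "card (- M) \<le> k + 1"
  using assms
proof (cases rule: index_family_cases)
  case (1 S T)
  with that[of "- T"] show ?thesis by auto
next
  case (2 S T U)
  obtain Q where Q: "Q \<subseteq> U" "card Q = k - card T + 1"
  proof (rule obtain_subset_with_card_n)
    show "k - card T + 1 \<le> card U" using 2 by simp
  qed
  show ?thesis
  proof (rule that[of "- (T \<union> Q)"])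
    show "card (- (- (T \<union> Q))) \<le> k + 1" using card_Un_le[of T Q] Q 2(5) by simp
    have "U \<inter> - (T \<union> Q) = U - Q" using 2 by auto
    then have "card (U \<inter> - (T \<union> Q)) = card U - card Q" using Q by (simp add: card_Diff_subset)
    also have "\<dots> < card U - (k - card T)" using Q 2 by simp
    finally show "ivec (- (T \<union> Q)) \<in> \<alpha>" using Q 2 by auto
  qed
qed

lemma index_family_basic:
  assumes "k \<ge> 1"
  shows "vertices01 \<in> index_family k A b"
    "fix_coords {i} 1 \<in> index_family k A b" "fix_coords {i} 0 \<in> index_family k A b"
proof -
  have tier: "{} \<in> tiers k A b" "{i} \<in> tiers k A b"
    using assms by (auto simp: tiers_def walls_def intro!: exI[of _ "\<lambda>_. {i}"])
  have fam: "one_zero (S - T) T \<in> index_family k A b"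
    if "S \<in> tiers k A b" "T \<subseteq> S" "card T \<le> k" for S T
    using that unfolding index_family_def by blast
  show "vertices01 \<in> index_family k A b"
    using fam[OF tier(1), of "{}"] by (simp add: one_zero_def fix_coords_def)
  show "fix_coords {i} 1 \<in> index_family k A b"
    using fam[OF tier(2), of "{}"] by (simp add: one_zero_def fix_coords_def Int_def cong: conj_cong)
  show "fix_coords {i} 0 \<in> index_family k A b"
    using fam[OF tier(2), of "{i}"] assms by (simp add: one_zero_def fix_coords_def Int_def cong: conj_cong)
qed

section \<open>A signed measure on matchings\<close>

lemma psubset_or_card: "finite S \<Longrightarrow> \<not> S \<subseteq> M \<Longrightarrow> card (S \<inter> M) < card S"
  by (rule psubset_card_mono) auto

locale odd_complete_graph =
  fixes n :: nat and ends :: "'e::finite \<Rightarrow> 'v::finite set"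
  assumes n_pos: "n \<ge> 1"
    and card_verts: "CARD('v) = 2 * n + 1"
    and bij_ends: "bij_betw ends UNIV (complete_graph_edges :: 'v set set)"
begin

lemma ends_edge: "ends e \<in> complete_graph_edges"
  using bij_ends by (auto simp: bij_betw_def)

lemma card_ends [simp]: "card (ends e) = 2"
  using ends_edge[of e] by (auto simp: complete_graph_edges_def)

section \<open>Degree counting and the matchings of size n\<close>

lemma handshake: "(\<Sum>v\<in>UNIV. \<Sum>e | v \<in> ends e. x e) = 2 * (\<Sum>e\<in>UNIV. x e)"
  for x :: "'e \<Rightarrow> real"
proof -
  have "(\<Sum>v\<in>UNIV. \<Sum>e | v \<in> ends e. x e) = (\<Sum>e\<in>UNIV. \<Sum>v | v \<in> ends e. x e)"
    using sum.swap_restrict[of "UNIV :: 'v set" "UNIV :: 'e set" "\<lambda>v. x" "\<lambda>v e. v \<in> ends e"]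
    by simp
  then show ?thesis by (simp add: sum_distrib_left)
qed

definition max_matchings :: "'e set set" where
  "max_matchings = {M. card M = n \<and> (\<forall>v. card {e \<in> M. v \<in> ends e} \<le> 1)}"

text \<open>Deleting v leaves a complete graph on 2n vertices, to which
  \<open>perfect_matching_avoiding\<close> applies. The free choice of the uncovered vertex serves
  the degree constraint at v.\<close>

lemma max_matching_avoiding:
  assumes "card Z \<le> 2 * n - 2"
  obtains M where "M \<in> max_matchings" "M \<inter> Z = {}" "\<And>e. e \<in> M \<Longrightarrow> v \<notin> ends e"
proof -
  obtain F where F: "F \<subseteq> {{u, w} | u w. u \<in> UNIV - {v} \<and> w \<in> UNIV - {v} \<and> u \<noteq> w}"
    "F \<inter> ends ` Z = {}" "\<And>u. u \<in> UNIV - {v} \<Longrightarrow> \<exists>!e. e \<in> F \<and> u \<in> e"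
  proof (rule perfect_matching_avoiding[of "UNIV - {v}" n "ends ` Z"])
    show "card (UNIV - {v}) = 2 * n" by (simp add: card_verts)
    show "card (ends ` Z) \<le> 2 * n - 2" using assms card_image_le[of Z ends] by simp
  qed (use n_pos in auto)
  define M where "M = {e. ends e \<in> F}"
  have v: "v \<notin> ends e" if "e \<in> M" for e
    using that F(1) by (auto simp: M_def)
  have deg: "card {e \<in> M. u \<in> ends e} = (if u = v then 0 else 1)" for u
  proof (cases "u = v")
    case True
    then have "{e \<in> M. u \<in> ends e} = {}" using v by auto
    with True show ?thesis by (metis card.empty)
  next
    case False
    then obtain d where d: "d \<in> F" "u \<in> d" and uniq: "\<And>e. e \<in> F \<Longrightarrow> u \<in> e \<Longrightarrow> e = d"
      using F(3)[of u] by auto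
    have "d \<in> complete_graph_edges" using d(1) F(1) unfolding complete_graph_edges_def by blast
    then obtain e where e: "ends e = d" using bij_ends by (metis bij_betw_imp_surj_on imageE)
    have "e' = e" if "e' \<in> M" "u \<in> ends e'" for e'
      using uniq[of "ends e'"] that e bij_betw_imp_inj_on[OF bij_ends] by (simp add: M_def inj_eq)
    then have "{e \<in> M. u \<in> ends e} = {e}" using d e by (auto simp: M_def)
    with False show ?thesis by simp
  qed
  \<comment> \<open>The size of \<open>M\<close> comes from counting incidences: all vertices except
    v have degree one.\<close>
  have "(\<Sum>u\<in>UNIV. \<Sum>e | u \<in> ends e. of_bool (e \<in> M)) = (\<Sum>u\<in>UNIV. of_bool (u \<noteq> v) :: real)"
  proof (rule sum.cong)
    fix u
    have "(\<Sum>e | u \<in> ends e. of_bool (e \<in> M) :: real) = real (card {e \<in> M. u \<in> ends e})"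
      by (simp add: sum.If_cases of_bool_def Int_def conj_commute)
    then show "(\<Sum>e | u \<in> ends e. of_bool (e \<in> M)) = (of_bool (u \<noteq> v) :: real)"
      by (simp add: deg)
  qed simp
  moreover have "(\<Sum>u\<in>UNIV. of_bool (u \<noteq> v) :: real) = real (card (UNIV - {v}))"
    by (simp add: of_bool_def sum.If_cases Compl_eq_Diff_UNIV[symmetric] Collect_neg_eq)
  moreover have "(\<Sum>e\<in>UNIV. of_bool (e \<in> M) :: real) = real (card M)"
    by (simp add: of_bool_def sum.If_cases)
  ultimately have "2 * real (card M) = real (2 * n)"
    using handshake[of "\<lambda>e. of_bool (e \<in> M)"] by (simp add: card_verts)
  then have "card M = n" by simp
  then have "M \<in> max_matchings" by (simp add: max_matchings_def deg)
  moreover have "M \<inter> Z = {}" using F(2) by (auto simp: M_def)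
  ultimately show ?thesis using that v by blast
qed

lemma card_max_matchings_pos: "card max_matchings > 0"
proof -
  obtain M where "M \<in> max_matchings" by (rule max_matching_avoiding[of "{}"]) simp_all
  then show ?thesis by (auto simp: card_gt_0_iff)
qed

text \<open>With N matchings of size n, each of them has weight at least 1/N, which is
  \<open>eps\<close> times the number of edges. A value of 1 at one such matching therefore
  outweighs any value up to the number of edges at the empty matching.\<close>

definition eps :: real where
  "eps = 1 / (real (card max_matchings) * real CARD('e))"

lemma eps_pos: "eps > 0"
  using card_max_matchings_pos by (simp add: eps_def)

section \<open>Integrals against the signed measure\<close>

definition integ :: "(real ^ 'e) set \<Rightarrow> ('e set \<Rightarrow> real) \<Rightarrow> real" where
  "integ \<beta> f =
     (1 + eps) / card max_matchings * (\<Sum>M\<in>max_matchings. of_bool (ivec M \<in> \<beta>) * f M)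
     - eps * (of_bool (ivec {} \<in> \<beta>) * f {})"

lemma integ_add: "integ \<beta> (\<lambda>M. f M + g M) = integ \<beta> f + integ \<beta> g"
  by (simp add: integ_def algebra_simps sum.distrib)

lemma integ_cmult: "integ \<beta> (\<lambda>M. c * f M) = c * integ \<beta> f"
proof -
  have "(\<Sum>M\<in>max_matchings. of_bool (ivec M \<in> \<beta>) * (c * f M))
      = c * (\<Sum>M\<in>max_matchings. of_bool (ivec M \<in> \<beta>) * f M)"
    unfolding sum_distrib_left by (simp only: mult.left_commute)
  then show ?thesis unfolding integ_def by (simp only:) (simp add: right_diff_distrib)
qed

lemma integ_diff: "integ \<beta> (\<lambda>M. f M - g M) = integ \<beta> f - integ \<beta> g"
  using integ_add[of \<beta> f "\<lambda>M. -1 * g M"] unfolding integ_cmult by simp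

lemma integ_sum: "integ \<beta> (\<lambda>M. \<Sum>i\<in>I. f i M) = (\<Sum>i\<in>I. integ \<beta> (f i))"
proof (cases "finite I")
  case True
  then show ?thesis
  proof (induction I)
    case empty
    show ?case by (simp add: integ_def)
  qed (simp add: integ_add)
qed (simp add: integ_def)

text \<open>Only the empty matching has negative weight, so the case to treat is that it lies in
  \<beta> and f is positive there. A matching of size n that avoids Z, Q and v then lies in \<beta>
  and has f at least 1, which suffices by the choice of \<open>eps\<close>.\<close>

lemma integ_nonneg:
  assumes f: "\<And>M. M \<in> max_matchings \<Longrightarrow> 0 \<le> f M"
    and \<beta>: "ivec {} \<in> \<beta> \<Longrightarrow> \<exists>Z. card Z \<le> r \<and> (\<forall>M. M \<inter> Z = {} \<longrightarrow> ivec M \<in> \<beta>)"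
    and zero: "f {} \<le> 0 \<or> f {} \<le> real CARD('e) \<and>
      (\<exists>Q v. card Q + r \<le> 2 * n - 2 \<and>
        (\<forall>M\<in>max_matchings. M \<inter> Q = {} \<and> (\<forall>e\<in>M. v \<notin> ends e) \<longrightarrow> 1 \<le> f M))"
  shows "0 \<le> integ \<beta> f"
proof -
  let ?s = "\<Sum>M\<in>max_matchings. of_bool (ivec M \<in> \<beta>) * f M"
  have s0: "0 \<le> ?s" using f by (intro sum_nonneg) auto
  have pos: "0 \<le> (1 + eps) / card max_matchings * ?s"
    using s0 eps_pos by (intro mult_nonneg_nonneg) auto
  show ?thesis
  proof (cases "ivec {} \<in> \<beta> \<and> f {} > 0")
    case False
    then have "eps * (of_bool (ivec {} \<in> \<beta>) * f {}) \<le> 0"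
      using eps_pos by (cases "ivec {} \<in> \<beta>") (auto simp: mult_le_0_iff)
    with pos show ?thesis by (simp add: integ_def)
  next
    case True
    then obtain Z where Z: "card Z \<le> r" "\<And>M. M \<inter> Z = {} \<Longrightarrow> ivec M \<in> \<beta>" using \<beta> by blast
    obtain Q v where Q: "card Q + r \<le> 2 * n - 2" "f {} \<le> real CARD('e)"
      "\<And>M. M \<in> max_matchings \<Longrightarrow> M \<inter> Q = {} \<Longrightarrow> (\<forall>e\<in>M. v \<notin> ends e) \<Longrightarrow> 1 \<le> f M"
      using zero True by force
    have "card (Q \<union> Z) \<le> 2 * n - 2" using card_Un_le[of Q Z] Q(1) Z(1) by simp
    then obtain M where M: "M \<in> max_matchings" "M \<inter> (Q \<union> Z) = {}" "\<And>e. e \<in> M \<Longrightarrow> v \<notin> ends e"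
      using max_matching_avoiding[of "Q \<union> Z" v] by metis
    have "1 \<le> of_bool (ivec M \<in> \<beta>) * f M" using M Q(3)[of M] Z(2)[of M] by auto
    also have "\<dots> \<le> ?s"
      using f M(1) by (intro member_le_sum) auto
    finally have s1: "1 \<le> ?s" .
    have "eps * f {} \<le> eps * real CARD('e)" using Q(2) eps_pos by simp
    also have "\<dots> = 1 / card max_matchings" by (simp add: eps_def)
    also have "\<dots> \<le> (1 + eps) / card max_matchings" using eps_pos by (simp add: divide_right_mono)
    also have "\<dots> \<le> (1 + eps) / card max_matchings * ?s"
      using mult_left_mono[OF s1, of "(1 + eps) / card max_matchings"] eps_pos by simp
    finally show ?thesis using True by (simp add: integ_def)
  qed
qed

definition prob :: "(real ^ 'e) set \<Rightarrow> (real ^ 'e) set \<Rightarrow> real" where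
  "prob \<beta> \<alpha> = integ \<beta> (\<lambda>M. of_bool (ivec M \<in> \<alpha>))"

text \<open>Dependence on the intersection alone yields the symmetry of the matrix and condition
  (BZ'4).\<close>

lemma prob_eq: "prob \<beta> \<alpha> = integ UNIV (\<lambda>M. of_bool (ivec M \<in> \<alpha> \<inter> \<beta>))"
  by (simp add: prob_def integ_def of_bool_conj mult.commute)

lemma prob_total: "prob vertices01 vertices01 = 1"
proof -
  have "max_matchings \<noteq> {}" using card_max_matchings_pos by (simp add: card_gt_0_iff)
  then show ?thesis by (simp add: prob_def integ_def)
qed

section \<open>The conditions on the columns\<close>

lemma card_star_le: "M \<in> max_matchings \<Longrightarrow> card {e \<in> M. v \<in> ends e} \<le> 1"
  by (simp add: max_matchings_def)

lemma prob_coord: "prob \<beta> (fix_coords {e} 1) = integ \<beta> (\<lambda>M. of_bool (e \<in> M))"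
  by (simp add: prob_def)

lemma prob_coord_0: "prob \<beta> (fix_coords {e} 0) = integ \<beta> (\<lambda>M. of_bool (e \<notin> M))"
  by (simp add: prob_def)

lemma prob_vertices01: "prob \<beta> vertices01 = integ \<beta> (\<lambda>M. 1)"
  by (simp add: prob_def)

text \<open>The essential inequality is the degree constraint, the integral of 1 minus the degree of
  v. The upper bound on a coordinate and the obstruction inequalities follow from it.\<close>

lemma xhat_prob_in_cone:
  assumes \<beta>: "ivec {} \<in> \<beta> \<Longrightarrow> \<exists>Z. card Z \<le> r \<and> (\<forall>M. M \<inter> Z = {} \<longrightarrow> ivec M \<in> \<beta>)"
    and r: "r + 1 \<le> 2 * n - 2 \<or> r = 0"
  shows "xhat (prob \<beta>) \<in> homog_cone (obstruction_relax k (MT_matrix ends) MT_rhs)"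
proof -
  let ?l = "prob \<beta> vertices01" and ?x = "\<lambda>e. prob \<beta> (fix_coords {e} 1)"
  have C: "1 \<le> real CARD('e)" by (simp add: Suc_le_eq)
  have x0: "0 \<le> ?x e" for e
    unfolding prob_coord by (rule integ_nonneg[OF _ \<beta>]) auto
  have star: "(\<Sum>e | v \<in> ends e. ?x e) \<le> ?l" for v
  proof -
    have "0 \<le> integ \<beta> (\<lambda>M. 1 - (\<Sum>e | v \<in> ends e. of_bool (e \<in> M)))"
    proof (rule integ_nonneg[OF _ \<beta>])
      have card: "(\<Sum>e | v \<in> ends e. of_bool (e \<in> M) :: real) = card {e \<in> M. v \<in> ends e}" for M
        by (simp add: sum.If_cases of_bool_def Int_def conj_commute)
      fix M assume "M \<in> max_matchings"
      then show "0 \<le> 1 - (\<Sum>e | v \<in> ends e. of_bool (e \<in> M) :: real)"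
        unfolding card using card_star_le[of M v] by simp
    next
      \<comment> \<open>The integrand is 1 at the empty matching and at every matching that leaves v
        uncovered, so no edges need to be avoided.\<close>
      show "1 - (\<Sum>e | v \<in> ends e. of_bool (e \<in> {})) \<le> (0::real) \<or>
        1 - (\<Sum>e | v \<in> ends e. of_bool (e \<in> {})) \<le> real CARD('e) \<and>
        (\<exists>Q va. card Q + r \<le> 2 * n - 2 \<and> (\<forall>M\<in>max_matchings. M \<inter> Q = {} \<and> (\<forall>e\<in>M. va \<notin> ends e) \<longrightarrow>
           (1::real) \<le> 1 - (\<Sum>e | v \<in> ends e. of_bool (e \<in> M))))"
        using r C by (intro disjI2 conjI exI[of _ "{}"] exI[of _ v]) (auto intro!: sum_nonpos)
    qed simp
    then show ?thesis unfolding integ_diff integ_sum prob_coord prob_vertices01 by simp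
  qed
  have xl: "?x e \<le> ?l" for e
  proof -
    have "ends e \<noteq> {}" by (metis card.empty card_ends zero_neq_numeral)
    then obtain v where v: "v \<in> ends e" by blast
    have "?x e \<le> (\<Sum>e | v \<in> ends e. ?x e)" using v x0 by (intro member_le_sum) auto
    with star[of v] show ?thesis by simp
  qed
  have l0: "0 \<le> ?l" using x0 xl order_trans by blast
  \<comment> \<open>If the total is 0, division by zero makes z the origin; all coordinates vanish
    as well, so scaling z still recovers them.\<close>
  define z where "z = (\<chi> e. ?x e / ?l)"
  have z: "z \<in> polytope_of (MT_matrix ends) MT_rhs"
  proof -
    have "(\<Sum>e | v \<in> ends e. z $ e) \<le> 1" for v
      using star[of v] l0 by (cases "?l = 0") (simp_all add: z_def sum_divide_distrib[symmetric])
    moreover have "z \<in> unit_cube"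
      using x0 xl l0 by (auto simp: z_def unit_cube_def divide_le_eq_1)
    ultimately show ?thesis by (simp add: polytope_of_MT)
  qed
  have "(\<Sum>i\<in>Ob. z $ i) \<le> real (card Ob) - 1"
    if Ob: "Ob \<in> small_obstructions k (MT_matrix ends) MT_rhs" for Ob
  proof -
    obtain v where sub: "Ob \<subseteq> row_support (MT_matrix ends) v"
      and big: "(\<Sum>j\<in>Ob. MT_matrix ends $ v $ j) > MT_rhs $ v"
      using Ob by (auto simp: small_obstructions_def)
    have sub': "Ob \<subseteq> {e. v \<in> ends e}"
      using sub by (auto simp: row_support_def MT_matrix_def split: if_splits)
    then have "(\<Sum>j\<in>Ob. MT_matrix ends $ v $ j) = (\<Sum>j\<in>Ob. 1)"
      by (intro sum.cong) (auto simp: MT_matrix_def)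
    \<comment> \<open>All coefficients and right-hand sides are 1, so an obstruction has at least
      two edges at one vertex and the degree constraint implies its inequality.\<close>
    then have "card Ob \<ge> 2" using big by (simp add: MT_rhs_def)
    moreover have "(\<Sum>i\<in>Ob. z $ i) \<le> (\<Sum>e | v \<in> ends e. z $ e)"
      using sub' x0 l0 by (intro sum_mono2) (auto simp: z_def)
    moreover have "(\<Sum>e | v \<in> ends e. z $ e) \<le> 1" using z by (simp add: polytope_of_MT)
    ultimately show ?thesis by simp
  qed
  with z have "z \<in> obstruction_relax k (MT_matrix ends) MT_rhs"
    by (simp add: obstruction_relax_def)
  moreover have "xhat (prob \<beta>) = (?l, ?l *\<^sub>R z)"
    using x0 xl by (auto simp: xhat_def z_def vec_eq_iff intro: antisym)
  ultimately show ?thesis using l0 by (auto simp: homog_cone_def)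
qed

text \<open>The equations hold pointwise, and each inequality integrates a pointwise nonnegative
  function. The number 2k + 3 is (k + 1) + (k + 2): edges avoided to stay in \<beta>, and edges
  avoided to make the integrand at least 1.\<close>

lemma column_ok_prob:
  assumes k: "k \<ge> 1" "2 * k + 3 \<le> 2 * n - 2"
    and \<beta>: "\<beta> \<in> index_family k (MT_matrix ends) MT_rhs"
  shows "column_ok k (MT_matrix ends) MT_rhs (prob \<beta>)"
proof -
  let ?A = "index_family k (MT_matrix ends) MT_rhs"
  have C: "1 \<le> real CARD('e)" by (simp add: Suc_le_eq)
  have robust: "\<exists>Z. card Z \<le> k + 1 \<and> (\<forall>M. M \<inter> Z = {} \<longrightarrow> ivec M \<in> \<alpha>)"
    if "\<alpha> \<in> ?A" "ivec {} \<in> \<alpha>" for \<alpha>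
    using index_family_zero[OF that] by blast
  have integ_ge: "0 \<le> integ \<beta> f"
    if "\<And>M. M \<in> max_matchings \<Longrightarrow> 0 \<le> f M"
      and "f {} \<le> 0 \<or> f {} \<le> real CARD('e) \<and>
        (\<exists>Q. card Q \<le> k + 2 \<and> (\<forall>M. M \<inter> Q = {} \<longrightarrow> 1 \<le> f M))" for f
  proof (rule integ_nonneg[of f \<beta> "k + 1", OF that(1) robust[OF \<beta>]])
    have "card Q + (k + 1) \<le> 2 * n - 2" if "card Q \<le> k + 2" for Q :: "'e set"
      using that k by simp
    then show "f {} \<le> 0 \<or> f {} \<le> real CARD('e) \<and>
      (\<exists>Q v. card Q + (k + 1) \<le> 2 * n - 2 \<and>
        (\<forall>M\<in>max_matchings. M \<inter> Q = {} \<and> (\<forall>e\<in>M. v \<notin> ends e) \<longrightarrow> 1 \<le> f M))"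
      using that(2) by blast
  qed
  have prob_ge: "0 \<le> prob \<beta> \<alpha>" if \<alpha>: "\<alpha> \<in> ?A" for \<alpha>
    unfolding prob_def
  proof (rule integ_ge)
    show "of_bool (ivec {} \<in> \<alpha>) \<le> (0::real) \<or> of_bool (ivec {} \<in> \<alpha>) \<le> real CARD('e) \<and>
        (\<exists>Q. card Q \<le> k + 2 \<and> (\<forall>M. M \<inter> Q = {} \<longrightarrow> (1::real) \<le> of_bool (ivec M \<in> \<alpha>)))"
    proof (cases "ivec {} \<in> \<alpha>")
      case True
      then obtain Z where "card Z \<le> k + 1" "\<forall>M. M \<inter> Z = {} \<longrightarrow> ivec M \<in> \<alpha>"
        using robust[OF \<alpha> True] by blast
      then have "\<exists>Q. card Q \<le> k + 2 \<and>
        (\<forall>M. M \<inter> Q = {} \<longrightarrow> (1::real) \<le> of_bool (ivec M \<in> \<alpha>))"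
        by (intro exI[of _ Z]) simp
      with True C show ?thesis by simp
    qed simp
  qed simp
  have prob_mono: "prob \<beta> \<alpha> \<le> prob \<beta> \<gamma>"
    if \<alpha>: "\<alpha> \<in> ?A" and sub: "\<And>M. ivec M \<in> \<alpha> \<Longrightarrow> ivec M \<in> \<gamma>"
      and \<gamma>: "ivec {} \<in> \<gamma> \<Longrightarrow> \<exists>i. \<forall>M. i \<notin> M \<longrightarrow> ivec M \<in> \<gamma>" for \<alpha> \<gamma>
  proof -
    have "0 \<le> integ \<beta> (\<lambda>M. of_bool (ivec M \<in> \<gamma>) - of_bool (ivec M \<in> \<alpha>))" (is "0 \<le> integ \<beta> ?f")
    proof (rule integ_ge)
      show "0 \<le> ?f M" for M using sub by auto
      show "?f {} \<le> 0 \<or> ?f {} \<le> real CARD('e) \<and>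
        (\<exists>Q. card Q \<le> k + 2 \<and> (\<forall>M. M \<inter> Q = {} \<longrightarrow> 1 \<le> ?f M))"
      proof (cases "ivec {} \<in> \<gamma> \<and> ivec {} \<notin> \<alpha>")
        case True
        \<comment> \<open>Avoiding s excludes M from \<alpha>, and avoiding i keeps it in \<gamma>,
          so the difference of indicators is 1.\<close>
        then obtain s i where "\<And>M. ivec M \<in> \<alpha> \<Longrightarrow> s \<in> M" "\<And>M. i \<notin> M \<Longrightarrow> ivec M \<in> \<gamma>"
          using index_family_nonzero[OF \<alpha>] \<gamma> by metis
        then have "1 \<le> ?f M" if "M \<inter> {i, s} = {}" for M using that by auto
        moreover have "card {i, s} \<le> k + 2" by (simp add: card_insert_if)
        moreover have "?f {} \<le> real CARD('e)" using C True by simp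
        ultimately show ?thesis by blast
      next
        case False
        then show ?thesis using sub[of "{}"] by auto
      qed
    qed
    then show ?thesis by (simp add: integ_diff prob_def)
  qed
  have coord_1: "prob \<beta> \<alpha> \<le> prob \<beta> (fix_coords {i} 1)"
    if "\<alpha> \<in> ?A" "\<And>M. ivec M \<in> \<alpha> \<Longrightarrow> i \<in> M" for \<alpha> i
    using that by (intro prob_mono) auto
  have coord_0: "prob \<beta> \<alpha> \<le> prob \<beta> (fix_coords {i} 0)"
    if "\<alpha> \<in> ?A" "\<And>M. ivec M \<in> \<alpha> \<Longrightarrow> i \<notin> M" for \<alpha> i
    using that by (intro prob_mono) auto
  have compl: "prob \<beta> (fix_coords {i} 1) + prob \<beta> (fix_coords {i} 0) = prob \<beta> vertices01" for i
    unfolding prob_def integ_add[symmetric] by (rule arg_cong[of _ _ "integ \<beta>"]) auto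
  have split: "prob \<beta> (one_zero S T) + prob \<beta> (one_zero (S \<union> {i}) (T - {i}))
      = prob \<beta> (one_zero S (T - {i}))" if "i \<in> T" for S T i
    unfolding prob_def integ_add[symmetric]
    by (rule arg_cong[of _ _ "integ \<beta>"]) (use that in \<open>auto simp: fun_eq_iff of_bool_def\<close>)
  have union: "(\<Sum>i\<in>S. prob \<beta> (fix_coords {i} 1)) + (\<Sum>i\<in>T. prob \<beta> (fix_coords {i} 0))
      - prob \<beta> (one_zero S T) \<le> (real (card S) + real (card T) - 1) * prob \<beta> vertices01" for S T
  proof -
    \<comment> \<open>This is the number of violated literals minus one, corrected to 0 when none is
      violated. At the empty matching only the literals from S fail; if there are at least two,
      avoiding two edges of S gives f at least 1.\<close>
    define f where "f M = (real (card S) + real (card T) - 1) * 1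
      - ((\<Sum>i\<in>S. of_bool (i \<in> M)) + (\<Sum>i\<in>T. of_bool (i \<notin> M)) - of_bool (ivec M \<in> one_zero S T))"
      for M
    have f: "f M = real (card S) + real (card T) - 1 - card (S \<inter> M) - card (T \<inter> - M)
      + of_bool (S \<subseteq> M \<and> T \<inter> M = {})" for M
      by (simp add: f_def of_bool_def sum.If_cases Collect_neg_eq)
    have "0 \<le> integ \<beta> f"
    proof (rule integ_ge)
      fix M
      have le: "card (S \<inter> M) \<le> card S" "card (T \<inter> - M) \<le> card T" by (simp_all add: card_mono)
      consider "S \<subseteq> M \<and> T \<inter> M = {}" | "\<not> S \<subseteq> M" | "\<not> T \<subseteq> - M" by blast
      then show "0 \<le> f M"
      proof cases
        case 1
        then show ?thesis using le by (simp add: f)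
      next
        case 2
        then show ?thesis using psubset_or_card[of S M] le by (simp add: f)
      next
        case 3
        then show ?thesis using psubset_or_card[of T "- M"] le by (simp add: f)
      qed
    next
      have f0: "f {} = real (card S) - 1 + of_bool (S = {})" by (simp add: f)
      show "f {} \<le> 0 \<or> f {} \<le> real CARD('e) \<and>
        (\<exists>Q. card Q \<le> k + 2 \<and> (\<forall>M. M \<inter> Q = {} \<longrightarrow> 1 \<le> f M))"
      proof (cases "card S \<ge> 2")
        case False
        then have "f {} \<le> 0" by (cases "S = {}") (auto simp: f0)
        then show ?thesis by simp
      next
        case True
        then obtain Q where Q: "Q \<subseteq> S" "card Q = 2" by (metis obtain_subset_with_card_n)
        have "1 \<le> f M" if "M \<inter> Q = {}" for M
        proof -
          have "card (S \<inter> M) \<le> card (S - Q)" using that by (intro card_mono) auto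
          also have "\<dots> = card S - 2" using Q by (simp add: card_Diff_subset)
          finally have "real (card (S \<inter> M)) \<le> real (card S) - 2" using True by linarith
          moreover have "card (T \<inter> - M) \<le> card T" by (simp add: card_mono)
          ultimately show ?thesis by (simp add: f)
        qed
        moreover have "f {} \<le> real CARD('e)"
          using True card_mono[of UNIV S] by (auto simp: f0)
        moreover have "card Q \<le> k + 2" using Q(2) by simp
        ultimately show ?thesis by blast
      qed
    qed
    then show ?thesis
      unfolding f_def integ_diff integ_add integ_sum integ_cmult
      by (simp add: prob_coord prob_coord_0 prob_vertices01 prob_def)
  qed
  have less_sum: "(real (card U) - (real r - 1)) * prob \<beta> (one_zero S T \<inter> sum_less U r)
      \<le> (\<Sum>i\<in>U. prob \<beta> (fix_coords {i} 0))"
    if \<alpha>: "one_zero S T \<inter> sum_less U r \<in> ?A" for S T U r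
  proof -
    let ?\<alpha> = "one_zero S T \<inter> sum_less U r"
    \<comment> \<open>The representation of the index is arbitrary here, so |U| <= r + k is read off
      from a point with few zeros.\<close>
    obtain M0 where M0: "ivec M0 \<in> ?\<alpha>" "card (- M0) \<le> k + 1"
      using index_family_few_zeros[OF \<alpha>] by blast
    have r: "r \<ge> 1" using M0(1) by auto
    have few: "card U + 1 \<le> r + (k + 1)"
    proof -
      have "card U = card (U \<inter> M0) + card (U - M0)"
        by (metis card_Int_Diff finite_class.finite_code)
      moreover have "card (U - M0) \<le> card (- M0)" by (intro card_mono) auto
      moreover have "card (U \<inter> M0) < r" using M0(1) by auto
      ultimately show ?thesis using M0(2) by simp
    qed
    show ?thesis
    proof (cases "r \<le> card U")
      case False
      have "0 \<le> prob \<beta> (fix_coords {i} 0)" for i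
        by (rule prob_ge[OF index_family_basic(3)[OF k(1)]])
      then have "0 \<le> (\<Sum>i\<in>U. prob \<beta> (fix_coords {i} 0))" by (simp add: sum_nonneg)
      moreover have "(real (card U) - (real r - 1)) * prob \<beta> ?\<alpha> \<le> 0"
        using False prob_ge[OF \<alpha>] by (intro mult_nonpos_nonneg) auto
      ultimately show ?thesis by simp
    next
      case True
      define c where "c = real (card U) - (real r - 1)"
      have c: "1 \<le> c" using True by (simp add: c_def)
      define f where "f M = (\<Sum>i\<in>U. of_bool (i \<notin> M)) - c * of_bool (ivec M \<in> ?\<alpha>)" for M
      have f: "f M = card (U \<inter> - M) - c * of_bool (ivec M \<in> ?\<alpha>)" for M
        by (simp add: f_def of_bool_def sum.If_cases Collect_neg_eq)
      have zeros: "real (card (U \<inter> - M)) = real (card U) - real (card (U \<inter> M))" for M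
      proof -
        have "card U = card (U \<inter> M) + card (U \<inter> - M)"
          by (metis Diff_eq card_Int_Diff finite_class.finite_code)
        then show ?thesis by simp
      qed
      have "0 \<le> integ \<beta> f"
      proof (rule integ_ge)
        fix M
        have "card (U \<inter> M) \<le> card U" by (simp add: card_mono)
        then show "0 \<le> f M"
          by (cases "ivec M \<in> ?\<alpha>") (auto simp: f zeros c_def)
      next
        show "f {} \<le> 0 \<or> f {} \<le> real CARD('e) \<and>
          (\<exists>Q. card Q \<le> k + 2 \<and> (\<forall>M. M \<inter> Q = {} \<longrightarrow> 1 \<le> f M))"
        proof (cases "S = {}")
          case True
          then have f0: "f {} = real r - 1" using r by (simp add: f c_def)
          show ?thesis
          proof (cases "r = 1")
            case True
            then show ?thesis by (simp add: f0)
          next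
            case False
            \<comment> \<open>Membership in the index already forces c = |U| - r + 1 zeros in U. One
              more zero gives a surplus of 1, and \<open>few\<close> bounds the size of Q by k +
              2.\<close>
            then have "card U - r + 2 \<le> card U" using r \<open>r \<le> card U\<close> by simp
            then obtain Q where Q: "Q \<subseteq> U" "card Q = card U - r + 2"
              by (metis obtain_subset_with_card_n)
            have "1 \<le> f M" if "M \<inter> Q = {}" for M
            proof -
              have "card Q \<le> card (U \<inter> - M)" using that Q(1) by (intro card_mono) auto
              then have "c + 1 \<le> card (U \<inter> - M)" using Q(2) \<open>r \<le> card U\<close> by (simp add: c_def)
              then show ?thesis using c by (auto simp: f)
            qed
            moreover have "card Q \<le> k + 2" using Q(2) few \<open>r \<le> card U\<close> by simp
            moreover have "f {} \<le> real CARD('e)"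
              using \<open>r \<le> card U\<close> card_mono[of UNIV U] by (simp add: f0)
            ultimately show ?thesis by blast
          qed
        next
          case False
          \<comment> \<open>Without s the indicator vanishes, and a single missing element of U
            makes the sum at least 1.\<close>
          then obtain s where s: "s \<in> S" by blast
          obtain i where i: "i \<in> U" using r True by fastforce
          have "1 \<le> f M" if "M \<inter> {i, s} = {}" for M
          proof -
            have "card {i} \<le> card (U \<inter> - M)" using that i by (intro card_mono) auto
            moreover have "f M = card (U \<inter> - M)" using that s by (auto simp: f)
            ultimately show ?thesis by simp
          qed
          moreover have "card {i, s} \<le> k + 2" by (simp add: card_insert_if)
          moreover have "f {} \<le> real CARD('e)"
            using False card_mono[of UNIV U] by (simp add: f)
          ultimately show ?thesis by blast
        qed
      qed
      then show ?thesis
        unfolding f_def integ_diff integ_sum integ_cmult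
        by (simp add: prob_coord_0 prob_def c_def)
    qed
  qed
  have incl_excl: "prob \<beta> (one_zero S T \<inter> sum_less U r) = prob \<beta> (one_zero S T)
      - (\<Sum>U' \<in> {U'. U' \<subseteq> U \<and> r \<le> card U'}. prob \<beta> (one_zero (S \<union> U') (T \<union> (U - U'))))"
    if disj: "S \<inter> U = {}" "T \<inter> U = {}" for S T U r
    unfolding prob_def integ_diff[symmetric] integ_sum[symmetric]
  proof (rule arg_cong[of _ _ "integ \<beta>"], rule ext)
    fix M
    \<comment> \<open>Since U is disjoint from S and T, only the trace of M on U can give a nonzero
      term.\<close>
    have "(\<Sum>U' \<in> {U'. U' \<subseteq> U \<and> r \<le> card U'}. of_bool (ivec M \<in> one_zero (S \<union> U') (T \<union> (U - U'))))
      = (\<Sum>U' \<in> {U'. U' \<subseteq> U \<and> r \<le> card U'}.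
          if U' = U \<inter> M then of_bool (ivec M \<in> one_zero S T) else (0::real))"
      by (intro sum.cong) (auto simp: of_bool_def)
    also have "\<dots> = of_bool (r \<le> card (U \<inter> M)) * of_bool (ivec M \<in> one_zero S T)"
      by (simp add: sum.delta)
    finally show "of_bool (ivec M \<in> one_zero S T \<inter> sum_less U r) = of_bool (ivec M \<in> one_zero S T)
      - (\<Sum>U' \<in> {U'. U' \<subseteq> U \<and> r \<le> card U'}. of_bool (ivec M \<in> one_zero (S \<union> U') (T \<union> (U - U'))) :: real)"
      by (auto simp: of_bool_def)
  qed
  have cone: "xhat (prob \<beta>) \<in> homog_cone (obstruction_relax k (MT_matrix ends) MT_rhs)"
    by (rule xhat_prob_in_cone[of _ "k + 1", OF robust[OF \<beta>]]) (use k in auto)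
  show ?thesis
    unfolding column_ok_def
  proof (intro conjI ballI allI impI)
    fix \<alpha> assume "\<alpha> \<in> ?A"
    then show "0 \<le> prob \<beta> \<alpha>" "prob \<beta> \<alpha> \<le> prob \<beta> vertices01"
      by (auto intro!: prob_ge prob_mono)
  next
    fix S T U r i
    assume "S \<inter> T = {} \<and> S \<inter> U = {} \<and> T \<inter> U = {} \<and> one_zero S T \<inter> sum_less U r \<in> ?A"
    then show "(real (card U) - (real r - 1)) * prob \<beta> (one_zero S T \<inter> sum_less U r)
        \<le> (\<Sum>i\<in>U. prob \<beta> (fix_coords {i} 0))"
      "prob \<beta> (one_zero S T \<inter> sum_less U r) = prob \<beta> (one_zero S T)
        - (\<Sum>U' \<in> {U'. U' \<subseteq> U \<and> r \<le> card U'}. prob \<beta> (one_zero (S \<union> U') (T \<union> (U - U'))))"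
      using less_sum[of S T U r] incl_excl[of S U T r] by auto
  next
    fix S T :: "'e set" and i assume "i \<in> T"
    then show "prob \<beta> (one_zero S T) + prob \<beta> (one_zero (S \<union> {i}) (T - {i}))
      = prob \<beta> (one_zero S (T - {i}))" by (rule split)
  qed (auto intro!: cone compl union coord_1 coord_0)
qed

lemma prob_in_BZ'_lift:
  assumes "k \<ge> 1" "2 * k + 3 \<le> 2 * n - 2"
  shows "(\<lambda>\<alpha> \<beta>. prob \<beta> \<alpha>) \<in> BZ'_lift k (MT_matrix ends) MT_rhs"
proof -
  have "prob \<beta> \<alpha> = 0"
    if "convex hull \<alpha> \<inter> convex hull \<beta> \<inter> polytope_of (MT_matrix ends) MT_rhs = {}" for \<alpha> \<beta>
  proof -
    have P: "ivec M \<in> polytope_of (MT_matrix ends) MT_rhs"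
      if "\<And>v. card {e \<in> M. v \<in> ends e} \<le> 1" for M
    proof -
      have "(\<Sum>e | v \<in> ends e. ivec M $ e) \<le> 1" for v
        using that[of v] unfolding sum_ivec by (simp add: Int_def conj_commute)
      then show ?thesis by (simp add: polytope_of_MT unit_cube_def del: sum_ivec)
    qed
    \<comment> \<open>Every point carrying mass is a matching, hence lies in the polytope. If it lay
      in both indices, it would lie in both hulls too, against the emptiness assumed in
      (BZ'3).\<close>
    have no: "ivec M \<notin> \<alpha> \<inter> \<beta>" if "M \<in> max_matchings \<or> M = {}" for M
      using P[of M] that \<open>_ = {}\<close> hull_subset[of \<alpha> convex] hull_subset[of \<beta> convex] card_star_le[of M]
      by auto
    then show ?thesis by (simp add: prob_eq integ_def del: Int_iff)
  qed
  moreover have "prob \<beta> \<alpha> = prob \<alpha> \<beta>" for \<alpha> \<beta>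
    by (simp only: prob_eq Int_commute)
  moreover have "prob \<beta>1 \<alpha>1 = prob \<beta>2 \<alpha>2" if "\<alpha>1 \<inter> \<beta>1 = \<alpha>2 \<inter> \<beta>2" for \<alpha>1 \<alpha>2 \<beta>1 \<beta>2
    using that by (simp only: prob_eq)
  ultimately show ?thesis
    using assms column_ok_prob prob_total unfolding BZ'_lift_def by blast
qed

section \<open>A point outside the integer hull and the rank bound\<close>

definition witness :: "real ^ 'e" where
  "witness = (\<chi> e. prob vertices01 (fix_coords {e} 1))"

lemma xhat_witness: "xhat (prob vertices01) = (1, witness)"
  by (simp add: xhat_def prob_total witness_def)

lemma witness_in_BZ':
  assumes "k = 0 \<or> 2 * k + 3 \<le> 2 * n - 2"
  shows "witness \<in> BZ' k (MT_matrix ends) MT_rhs"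
proof (cases "k = 0")
  case True
  \<comment> \<open>The first component is 1, so membership in the cone is membership in the
    polytope itself. Every 0/1 point is allowed, so no edges have to be avoided and r = 0.\<close>
  have "xhat (prob vertices01) \<in> homog_cone (obstruction_relax 0 (MT_matrix ends) MT_rhs)"
    by (rule xhat_prob_in_cone[of _ 0]) (auto intro!: exI[of _ "{}"])
  then have "witness \<in> polytope_of (MT_matrix ends) MT_rhs"
    by (auto simp: xhat_witness homog_cone_def obstruction_relax_def)
  with True show ?thesis by (simp add: BZ'_def)
next
  case False
  then have "k \<ge> 1" "2 * k + 3 \<le> 2 * n - 2" using assms by auto
  from prob_in_BZ'_lift[OF this] xhat_witness False show ?thesis
    unfolding BZ'_def by auto
qed

text \<open>Summing the degree constraints gives 2|M| <= 2n + 1 at a 0/1 point, and integrality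
  rounds this down to n. The half-space is convex, so the bound passes to the hull.\<close>

lemma integer_hull_sum_le:
  assumes "x \<in> integer_hull (polytope_of (MT_matrix ends) MT_rhs)"
  shows "(\<Sum>e\<in>UNIV. x $ e) \<le> real n"
proof -
  have "integer_hull (polytope_of (MT_matrix ends) MT_rhs) \<subseteq> {x. (\<Sum>e\<in>UNIV. x $ e) \<le> real n}"
    unfolding integer_hull_def
  proof (rule hull_minimal)
    show "polytope_of (MT_matrix ends) MT_rhs \<inter> vertices01 \<subseteq> {x. (\<Sum>e\<in>UNIV. x $ e) \<le> real n}"
    proof
      fix x assume x: "x \<in> polytope_of (MT_matrix ends) MT_rhs \<inter> vertices01"
      then have "x = ivec {e. x $ e = 1}" by (auto simp: vec_eq_iff vertices01_def)
      then have s: "(\<Sum>e\<in>UNIV. x $ e) = real (card {e. x $ e = 1})"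
        by (metis Int_UNIV_left sum_ivec)
      have "2 * (\<Sum>e\<in>UNIV. x $ e) \<le> (\<Sum>v\<in>(UNIV :: 'v set). 1)"
        unfolding handshake[symmetric] using x by (intro sum_mono) (auto simp: polytope_of_MT)
      then have "2 * real (card {e. x $ e = 1}) \<le> real (2 * n + 1)" by (simp add: s card_verts)
      then have "card {e. x $ e = 1} \<le> n" by linarith
      then show "x \<in> {x. (\<Sum>e\<in>UNIV. x $ e) \<le> real n}" by (simp add: s)
    qed
    have "{x :: real ^ 'e. (\<Sum>e\<in>UNIV. x $ e) \<le> real n} = {x. (\<chi> e. 1) \<bullet> x \<le> real n}"
      by (simp add: inner_vec_def)
    then show "convex {x :: real ^ 'e. (\<Sum>e\<in>UNIV. x $ e) \<le> real n}"
      by (simp add: convex_halfspace_le)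
  qed
  with assms show ?thesis by blast
qed

text \<open>The empty matching contributes nothing to the expected size, so removing mass there
  leaves (1 + \<open>eps\<close>) n.\<close>

lemma witness_sum: "(\<Sum>e\<in>UNIV. witness $ e) > real n"
proof -
  have "(\<Sum>e\<in>UNIV. witness $ e) = integ vertices01 (\<lambda>M. \<Sum>e\<in>UNIV. of_bool (e \<in> M))"
    unfolding integ_sum by (simp add: witness_def prob_coord)
  also have "\<dots> = integ vertices01 (\<lambda>M. real (card M))"
    by (simp add: of_bool_def sum.If_cases)
  also have "\<dots> = (1 + eps) / card max_matchings * (\<Sum>M\<in>max_matchings. real n)"
    by (simp add: integ_def max_matchings_def)
  also have "\<dots> = (1 + eps) * real n" using card_max_matchings_pos by (simp add: card_gt_0_iff)
  also have "\<dots> > real n" using eps_pos n_pos by (simp add: distrib_right)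
  finally show ?thesis .
qed

end

theorem theorem6:
  fixes n :: nat and ends :: "'e::finite \<Rightarrow> 'v::finite set"
  assumes "n \<ge> 1"
    and "CARD('v) = 2 * n + 1"
    and "bij_betw ends UNIV (complete_graph_edges :: 'v set set)"
  shows "enat (nat \<lceil>sqrt (2 * real n) - 3 / 2\<rceil>)
           \<le> BZ'_rank (MT_matrix ends) (MT_rhs :: real ^ 'v)"
proof -
  interpret odd_complete_graph n ends using assms by unfold_locales
  show ?thesis
    unfolding BZ'_rank_def
  proof (rule INF_greatest)
    fix k assume "k \<in> {k. BZ' k (MT_matrix ends) (MT_rhs :: real ^ 'v)
      = integer_hull (polytope_of (MT_matrix ends) MT_rhs)}"
    then have hull: "BZ' k (MT_matrix ends) MT_rhs = integer_hull (polytope_of (MT_matrix ends) MT_rhs)"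
      by simp
    have "witness \<notin> BZ' k (MT_matrix ends) MT_rhs"
      unfolding hull
    proof
      assume "witness \<in> integer_hull (polytope_of (MT_matrix ends) MT_rhs)"
      then show False using integer_hull_sum_le[of witness] witness_sum by linarith
    qed
    then have k: "\<not> (k = 0 \<or> 2 * k + 3 \<le> 2 * n - 2)"
      using witness_in_BZ' by blast
    \<comment> \<open>The construction gives the linear bound 2n <= 2k + 4. For k >= 1 this is at
      most \<open>k\<^sup>2\<close> + 3k + 2, which falls short of the square of k + 3/2 by
      1/4.\<close>
    have "k\<^sup>2 + k \<ge> 2" using k by (cases k) (auto simp: power2_eq_square)
    then have "2 * n \<le> k\<^sup>2 + 3 * k + 2" using k by linarith
    then have "real (2 * n) \<le> real (k\<^sup>2 + 3 * k + 2)" by (simp only: of_nat_le_iff)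
    then have "2 * real n \<le> (real k)\<^sup>2 + 3 * real k + 2" by simp
    also have "\<dots> \<le> (real k + 3 / 2)\<^sup>2" by (simp add: power2_eq_square field_simps)
    finally have "sqrt (2 * real n) \<le> real k + 3 / 2" by (intro real_le_lsqrt) auto
    then have "nat \<lceil>sqrt (2 * real n) - 3 / 2\<rceil> \<le> k" by (simp add: nat_le_iff ceiling_le_iff)
    then show "enat (nat \<lceil>sqrt (2 * real n) - 3 / 2\<rceil>) \<le> enat k" by simp
  qed
qed

end
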